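(* For every integer $n\geq 1$, all real numbers $a,b>0$ and all $x$, \[ \sum_{l=0}^{n}\binom{n}{l}\frac{(a)_{l}(b)_{n-l}}{(a+b)_{n}}E_{l}(x)E_{n-l}(x) = \frac{4}{n+1}B_{n+1}(x) -\frac{2}{n+1}\sum_{l=0}^{n+1}\binom{n+1}{l} \frac{(a)_{l}+(b)_{l}}{(a+b)_l}E_l(0)B_{n+1-l}(x). \]
   Context: The Euler polynomials $E_n(x)$ are defined by $\frac{2e^{xz}}{e^z+1}=\sum_{n\ge0}E_n(x)\frac{z^n}{n!}$. The Bernoulli polynomials $B_n(x)$ are defined by $\frac{ze^{xz}}{e^z-1}=\sum_{n\ge0}B_n(x)\frac{z^n}{n!}$. The Pochhammer symbol is $(z)_0=1$, $(z)_m=z(z+1)\cdots(z+m-1)$ for $m\ge1$. *)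

theory Defs
  imports Complex_Main "HOL-Computational_Algebra.Formal_Power_Series"
begin

text \<open>The values \<open>E\<^sub>n(x)\<close> and \<open>B\<^sub>n(x)\<close> are read off from the generating functions, taken as
  formal power series in \<open>z\<close>. In \<open>bernpoly\<close> the denominator has zero constant term; \<open>/\<close> on
  power series over a field cancels the common factor \<open>z\<close>, so the quotient is the intended one
  (see \<open>bernpoly_gf\<close>).\<close>

definition eulerpoly :: "nat \<Rightarrow> 'a::field_char_0 \<Rightarrow> 'a" where
  "eulerpoly n x = fact n * fps_nth (2 * fps_exp x / (fps_exp 1 + 1)) n"

definition bernpoly :: "nat \<Rightarrow> 'a::field_char_0 \<Rightarrow> 'a" where
  "bernpoly n x = fact n * fps_nth (fps_X * fps_exp x / (fps_exp 1 - 1)) n"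

lemma eulerpoly_gf:
  "Abs_fps (\<lambda>n. eulerpoly n x / fact n) * (fps_exp 1 + 1) = 2 * fps_exp x"
proof -
  have "Abs_fps (\<lambda>n. eulerpoly n x / fact n) = 2 * fps_exp x / (fps_exp 1 + 1)"
    by (simp add: fps_eq_iff eulerpoly_def)
  moreover have "fps_nth (fps_exp 1 + 1 :: 'a fps) 0 \<noteq> 0"
    by simp
  ultimately show ?thesis
    by (simp add: fps_divide_unit mult.assoc inverse_mult_eq_1)
qed

lemma bernpoly_gf:
  "Abs_fps (\<lambda>n. bernpoly n x / fact n) * (fps_exp 1 - 1) = fps_X * fps_exp x"
proof -
  have *: "Abs_fps (\<lambda>n. bernpoly n x / fact n) = fps_X * fps_exp x / (fps_exp 1 - 1)"
    by (simp add: fps_eq_iff bernpoly_def)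
  have "subdegree (fps_exp 1 - 1 :: 'a fps) = 1"
    by (rule subdegreeI) auto
  moreover have "fps_exp 1 - 1 \<noteq> (0 :: 'a fps)"
    using \<open>subdegree (fps_exp 1 - 1 :: 'a fps) = 1\<close> by auto
  ultimately have "(fps_exp 1 - 1 :: 'a fps) dvd fps_X * fps_exp x"
    by (subst fps_dvd_iff) auto
  then show ?thesis
    unfolding * by (rule dvd_div_mult_self)
qed

end

theory Submission
  imports Defs "HOL-Computational_Algebra.Polynomial"
begin

text \<open>
  With \<open>u = exp (t z)\<close> and \<open>v = exp ((1 - t) z)\<close> one has \<open>u v = exp z\<close> and
  \<open>(u v - 1) / ((u + 1) (v + 1)) = 1 - 1 / (u + 1) - 1 / (v + 1)\<close>. Multiplying by
  \<open>4 z exp (x z) / (exp z - 1)\<close> and comparing coefficients of \<open>z\<close> gives an identity that is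
  polynomial in \<open>t\<close>. The theorem is its expectation under the Beta distribution with parameters
  \<open>a\<close> and \<open>b\<close>, for which \<open>t ^ i * (1 - t) ^ j\<close> has expectation
  \<open>(a)\<^sub>i (b)\<^sub>j / (a + b)\<^bsub>i + j\<^esub>\<close>. No integration is needed: the expectation is the linear
  functional on polynomials that sends \<open>t ^ k\<close> to \<open>(a)\<^sub>k / (a + b)\<^sub>k\<close>.
\<close>

text \<open>Substitution of \<open>t z\<close> for \<open>z\<close> in \<open>eulerpoly_gf\<close>:
  composing with \<open>fps_const t * fps_X\<close> multiplies the \<open>n\<close>-th coefficient
  by \<open>t ^ n\<close>, and \<open>t = 0\<close> needs no separate case.\<close>

lemma eulerpoly_gf_scaled:
  fixes x t :: "'a::field_char_0"
  shows "Abs_fps (\<lambda>n. t ^ n * eulerpoly n x / fact n) * (fps_exp t + 1) = 2 * fps_exp (x * t)"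
proof -
  have lin: "f oo (fps_const t * fps_X) = Abs_fps (\<lambda>n. t ^ n * fps_nth f n)" for f :: "'a fps"
    by (rule fps_compose_linear)
  have "(Abs_fps (\<lambda>n. eulerpoly n x / fact n) * (fps_exp 1 + 1)) oo (fps_const t * fps_X)
          = (2 * fps_exp x) oo (fps_const t * fps_X)"
    by (simp only: eulerpoly_gf)
  then have "(Abs_fps (\<lambda>n. eulerpoly n x / fact n) oo (fps_const t * fps_X)) * (fps_exp t + 1)
          = 2 * fps_exp (x * t)"
    by (simp add: fps_compose_mult_distrib fps_compose_add_distrib fps_exp_compose_linear mult.commute[of x t])
  then show ?thesis
    by (simp add: lin)
qed

lemma euler_gf_product:
  fixes x s t :: "'a::field_char_0"
  assumes "t + s = 1"
  defines "G \<equiv> \<lambda>x t. Abs_fps (\<lambda>n. t ^ n * eulerpoly n x / fact n)"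
    and "B \<equiv> Abs_fps (\<lambda>n. bernpoly n x / fact n)"
  shows "fps_X * (G x t * G x s) = 4 * B - 2 * ((G 0 t + G 0 s) * B)"
proof -
  define U V D where "U = (fps_exp t :: 'a fps)" and "V = (fps_exp s :: 'a fps)"
    and "D = (fps_exp 1 :: 'a fps)"
  have G: "G x t * (U + 1) = 2 * fps_exp (x * t)" "G x s * (V + 1) = 2 * fps_exp (x * s)"
    "G 0 t * (U + 1) = 2" "G 0 s * (V + 1) = 2"
    using eulerpoly_gf_scaled[of t x] eulerpoly_gf_scaled[of s x]
      eulerpoly_gf_scaled[of t 0] eulerpoly_gf_scaled[of s 0]
    by (simp_all add: G_def U_def V_def)
  have B: "B * (D - 1) = fps_X * fps_exp x"
    unfolding B_def D_def by (rule bernpoly_gf)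
  have UV: "U * V = D"
    by (simp add: U_def V_def D_def assms(1) flip: fps_exp_add_mult)
  have E: "fps_exp (x * t) * fps_exp (x * s) = fps_exp x"
    by (simp add: assms(1) flip: fps_exp_add_mult distrib_left)
  have "fps_nth (U + 1) 0 \<noteq> 0" "fps_nth (V + 1) 0 \<noteq> 0" "fps_nth (D - 1) 1 \<noteq> 0"
    by (simp_all add: U_def V_def D_def)
  \<comment> \<open>The constant term of \<open>D - 1\<close> vanishes, so it is not a unit. Being
    nonzero is enough, since power series over a field form an integral domain and the common
    denominator can be cancelled at the end.\<close>
  then have nz: "(U + 1) * (V + 1) * (D - 1) \<noteq> 0"
    by (metis fps_zero_nth mult_eq_0_iff)
  have "fps_X * (G x t * G x s) * ((U + 1) * (V + 1) * (D - 1))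
      = fps_X * ((G x t * (U + 1)) * (G x s * (V + 1))) * (D - 1)"
    by (simp only: mult_ac)
  also have "\<dots> = 4 * (fps_X * (fps_exp (x * t) * fps_exp (x * s))) * (D - 1)"
    by (simp add: G mult_ac)
  also have "\<dots> = 4 * (B * (D - 1)) * (D - 1)"
    by (simp only: E B)
  \<comment> \<open>The partial fraction identity with denominators cleared:
    \<open>(U + 1) * (V + 1) - (V + 1) - (U + 1) = U * V - 1 = D - 1\<close>. The products
    \<open>2 * 2\<close> stay unevaluated so that one factor 2 can become
    \<open>G 0 t * (U + 1)\<close> or \<open>G 0 s * (V + 1)\<close>.\<close>
  also have "\<dots> = B * (D - 1) * (4 * ((U + 1) * (V + 1)) - 2 * 2 * (V + 1) - 2 * 2 * (U + 1))"
    by (simp add: algebra_simps flip: UV)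
  also have "\<dots> = B * (D - 1) * (4 * ((U + 1) * (V + 1))
      - 2 * (G 0 t * (U + 1)) * (V + 1) - 2 * (G 0 s * (V + 1)) * (U + 1))"
    by (simp only: G)
  also have "\<dots> = (4 * B - 2 * ((G 0 t + G 0 s) * B)) * ((U + 1) * (V + 1) * (D - 1))"
    by (simp only: algebra_simps)
  finally show ?thesis
    using nz by (metis mult_right_cancel)
qed

lemma fact_mult_fps_nth_mult:
  fixes f g :: "nat \<Rightarrow> 'a::field_char_0"
  shows "fact n * fps_nth (Abs_fps (\<lambda>k. f k / fact k) * Abs_fps (\<lambda>k. g k / fact k)) n
    = (\<Sum>k\<le>n. of_nat (n choose k) * f k * g (n - k))"
  unfolding fps_mult_nth atLeast0AtMost sum_distrib_left
  by (rule sum.cong) (simp_all add: binomial_fact)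

text \<open>Comparison of coefficients of \<open>z ^ Suc n\<close> in
  \<open>euler_gf_product\<close>. The factor \<open>fps_X\<close> lowers the index on the left to
  \<open>n\<close>, and \<open>fact (Suc n) = of_nat (Suc n) * fact n\<close> yields the leading
  factor.\<close>

lemma euler_convolution:
  fixes x s t :: "'a::field_char_0"
  assumes "t + s = 1"
  shows "of_nat (Suc n) * (\<Sum>l\<le>n. of_nat (n choose l) * (t ^ l * s ^ (n - l)) * eulerpoly l x * eulerpoly (n - l) x)
    = 4 * bernpoly (Suc n) x
      - 2 * (\<Sum>l\<le>Suc n. of_nat (Suc n choose l) * (t ^ l + s ^ l) * eulerpoly l 0 * bernpoly (Suc n - l) x)"
proof -
  define G where "G = (\<lambda>x t :: 'a. Abs_fps (\<lambda>n. t ^ n * eulerpoly n x / fact n))"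
  define B where "B = Abs_fps (\<lambda>n. bernpoly n x / fact n)"
  have 1: "(\<Sum>l\<le>n. of_nat (n choose l) * (t ^ l * s ^ (n - l)) * eulerpoly l x * eulerpoly (n - l) x)
      = fact n * fps_nth (G x t * G x s) n"
    unfolding G_def fact_mult_fps_nth_mult by (simp add: mult_ac)
  have "G 0 t + G 0 s = Abs_fps (\<lambda>n. (t ^ n + s ^ n) * eulerpoly n 0 / fact n)"
    by (simp add: G_def fps_eq_iff add_divide_distrib distrib_right)
  then have 2: "(\<Sum>l\<le>Suc n. of_nat (Suc n choose l) * (t ^ l + s ^ l) * eulerpoly l 0 * bernpoly (Suc n - l) x)
      = fact (Suc n) * fps_nth ((G 0 t + G 0 s) * B) (Suc n)"
    unfolding B_def by (simp only: fact_mult_fps_nth_mult mult.assoc)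
  have "fps_nth (fps_X * (G x t * G x s)) (Suc n)
      = fps_nth (4 * B - 2 * ((G 0 t + G 0 s) * B)) (Suc n)"
    using euler_gf_product[OF assms, of x] by (simp only: G_def B_def)
  then have "fps_nth (G x t * G x s) n
      = 4 * fps_nth B (Suc n) - 2 * fps_nth ((G 0 t + G 0 s) * B) (Suc n)"
    by (simp add: numeral_fps_const)
  then have "fact (Suc n) * fps_nth (G x t * G x s) n
      = 4 * (fact (Suc n) * fps_nth B (Suc n)) - 2 * (fact (Suc n) * fps_nth ((G 0 t + G 0 s) * B) (Suc n))"
    by (simp only: right_diff_distrib mult.left_commute)
  moreover have "fact (Suc n) * fps_nth B (Suc n) = bernpoly (Suc n) x"
    by (simp add: B_def del: fact_Suc)
  ultimately show ?thesis
    unfolding 1 2 by (simp only: fact_Suc mult.assoc)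
qed

text \<open>The expectation of \<open>p\<close> under the Beta distribution if \<open>degree p \<le> N\<close>; cutting off at a fixed
  \<open>N\<close> makes it linear on all polynomials.\<close>

definition beta_moment :: "nat \<Rightarrow> 'a::field_char_0 \<Rightarrow> 'a \<Rightarrow> 'a poly \<Rightarrow> 'a" where
  "beta_moment N a b p = (\<Sum>k\<le>N. coeff p k * (pochhammer a k / pochhammer (a + b) k))"

lemma beta_moment_add: "beta_moment N a b (p + q) = beta_moment N a b p + beta_moment N a b q"
  by (simp add: beta_moment_def sum.distrib distrib_right add_divide_distrib)

lemma beta_moment_diff: "beta_moment N a b (p - q) = beta_moment N a b p - beta_moment N a b q"
  by (simp add: beta_moment_def sum_subtractf left_diff_distrib diff_divide_distrib)

lemma beta_moment_smult: "beta_moment N a b (smult c p) = c * beta_moment N a b p"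
  by (simp add: beta_moment_def sum_distrib_left mult.assoc)

lemma beta_moment_sum: "beta_moment N a b (\<Sum>i\<in>A. f i) = (\<Sum>i\<in>A. beta_moment N a b (f i))"
  unfolding beta_moment_def coeff_sum sum_distrib_right by (rule sum.swap)

text \<open>Induction on \<open>j\<close> for all \<open>i\<close> at once, splitting one factor
  \<open>1 - t\<close>: the moment for \<open>(i, Suc j)\<close> is the one for
  \<open>(i, j)\<close> minus the one for \<open>(Suc i, j)\<close>.\<close>

lemma beta_moment_monomial:
  fixes a b :: "'a::field_char_0"
  assumes nz: "\<And>k. pochhammer (a + b) k \<noteq> 0" and "i + j \<le> N"
  shows "beta_moment N a b ([:0, 1:] ^ i * [:1, -1:] ^ j)
    = pochhammer a i * pochhammer b j / pochhammer (a + b) (i + j)"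
  using assms(2)
proof (induction j arbitrary: i)
  case 0
  have "[:0, 1 :: 'a:] ^ i = monom 1 i"
    by (simp add: monom_altdef)
  then have "beta_moment N a b ([:0, 1:] ^ i * [:1, -1:] ^ 0)
      = (\<Sum>k\<le>N. if i = k then pochhammer a k / pochhammer (a + b) k else 0)"
    unfolding beta_moment_def by (intro sum.cong) simp_all
  with 0 show ?case
    by simp
next
  case (Suc j)
  have "[:1, -1:] = 1 - [:0, 1 :: 'a:]"
    by (simp add: one_pCons)
  then have "[:0, 1:] ^ i * [:1, -1:] ^ Suc j
      = [:0, 1:] ^ i * [:1, -1:] ^ j - [:0, 1:] ^ Suc i * [:1, -1 :: 'a:] ^ j"
    by (simp add: algebra_simps)
  then have "beta_moment N a b ([:0, 1:] ^ i * [:1, -1:] ^ Suc j)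
      = pochhammer a i * pochhammer b j / pochhammer (a + b) (i + j)
        - pochhammer a (Suc i) * pochhammer b j / pochhammer (a + b) (Suc i + j)"
    using Suc.IH[of i] Suc.IH[of "Suc i"] Suc.prems by (simp only: beta_moment_diff)
  also have "\<dots> = pochhammer a i * pochhammer b (Suc j) / pochhammer (a + b) (i + Suc j)"
  proof -
    define P q where "P = pochhammer (a + b) (i + j)" and "q = a + b + of_nat (i + j)"
    have Pq: "pochhammer (a + b) (Suc (i + j)) = P * q"
      by (simp add: P_def q_def pochhammer_Suc)
    then have "P \<noteq> 0" "q \<noteq> 0"
      using nz[of "Suc (i + j)"] by auto
    \<comment> \<open>After the common factors are taken out, the claim is
      \<open>1 - (a + i) / q = (b + j) / q\<close>.\<close>
    moreover have "b + of_nat j = q - (a + of_nat i)"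
      by (simp add: q_def)
    ultimately show ?thesis
      by (simp add: Pq P_def[symmetric] pochhammer_Suc[of a] pochhammer_Suc[of b] divide_simps)
        (simp add: algebra_simps)
  qed
  finally show ?case .
qed

lemma euler_beta_convolution:
  fixes a b x :: "'a::field_char_0"
  assumes nz: "\<And>k. pochhammer (a + b) k \<noteq> 0"
  shows "of_nat (Suc n) * (\<Sum>l\<le>n. of_nat (n choose l)
        * (pochhammer a l * pochhammer b (n - l) / pochhammer (a + b) n) * eulerpoly l x * eulerpoly (n - l) x)
    = 4 * bernpoly (Suc n) x
      - 2 * (\<Sum>l\<le>Suc n. of_nat (Suc n choose l)
        * ((pochhammer a l + pochhammer b l) / pochhammer (a + b) l) * eulerpoly l 0 * bernpoly (Suc n - l) x)"
proof -
  \<comment> \<open>The cutoff is \<open>Suc n\<close> because the right-hand sum contains powers up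
    to \<open>t ^ Suc n\<close>.\<close>
  define M where "M = beta_moment (Suc n) a b"
  define T S where "T = [:0, 1 :: 'a:]" and "S = [:1, -1 :: 'a:]"
  define c where "c = (\<lambda>l. of_nat (n choose l) * eulerpoly l x * eulerpoly (n - l) x)"
  define d where "d = (\<lambda>l. of_nat (Suc n choose l) * eulerpoly l 0 * bernpoly (Suc n - l) x)"
  \<comment> \<open>Trivial powers such as \<open>S ^ 0\<close> are kept so that every term has the
    shape \<open>T ^ i * S ^ j\<close> evaluated by \<open>beta_moment_monomial\<close>.\<close>
  have "poly (smult (of_nat (Suc n)) (\<Sum>l\<le>n. smult (c l) (T ^ l * S ^ (n - l)))) t
      = poly (smult (4 * bernpoly (Suc n) x) (T ^ 0 * S ^ 0)
        - smult 2 (\<Sum>l\<le>Suc n. smult (d l) (T ^ l * S ^ 0 + T ^ 0 * S ^ l))) t" for t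
    using euler_convolution[of t "1 - t" n x]
    by (simp add: poly_sum T_def S_def c_def d_def mult_ac del: sum.atMost_Suc binomial_Suc_Suc of_nat_Suc)
  then have "smult (of_nat (Suc n)) (\<Sum>l\<le>n. smult (c l) (T ^ l * S ^ (n - l)))
      = smult (4 * bernpoly (Suc n) x) (T ^ 0 * S ^ 0)
        - smult 2 (\<Sum>l\<le>Suc n. smult (d l) (T ^ l * S ^ 0 + T ^ 0 * S ^ l))"
    \<comment> \<open>A field of characteristic 0 is infinite, so agreement at every
      \<open>t\<close> gives equality of polynomials.\<close>
    by (intro poly_eq_poly_eq_iff[THEN iffD1] ext)
  then have "M (smult (of_nat (Suc n)) (\<Sum>l\<le>n. smult (c l) (T ^ l * S ^ (n - l))))
      = M (smult (4 * bernpoly (Suc n) x) (T ^ 0 * S ^ 0)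
        - smult 2 (\<Sum>l\<le>Suc n. smult (d l) (T ^ l * S ^ 0 + T ^ 0 * S ^ l)))"
    by (rule arg_cong)
  then have lin: "of_nat (Suc n) * (\<Sum>l\<le>n. c l * M (T ^ l * S ^ (n - l)))
      = 4 * bernpoly (Suc n) x * M (T ^ 0 * S ^ 0)
        - 2 * (\<Sum>l\<le>Suc n. d l * (M (T ^ l * S ^ 0) + M (T ^ 0 * S ^ l)))"
    by (simp only: M_def beta_moment_add beta_moment_diff beta_moment_smult beta_moment_sum)
  have M: "M (T ^ i * S ^ j) = pochhammer a i * pochhammer b j / pochhammer (a + b) (i + j)"
    if "i + j \<le> Suc n" for i j
    unfolding M_def T_def S_def using nz that by (rule beta_moment_monomial)
  have "(\<Sum>l\<le>n. c l * M (T ^ l * S ^ (n - l))) = (\<Sum>l\<le>n. of_nat (n choose l)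
        * (pochhammer a l * pochhammer b (n - l) / pochhammer (a + b) n) * eulerpoly l x * eulerpoly (n - l) x)"
    by (rule sum.cong) (simp_all add: M c_def)
  moreover have "(\<Sum>l\<le>Suc n. d l * (M (T ^ l * S ^ 0) + M (T ^ 0 * S ^ l)))
      = (\<Sum>l\<le>Suc n. of_nat (Suc n choose l)
        * ((pochhammer a l + pochhammer b l) / pochhammer (a + b) l) * eulerpoly l 0 * bernpoly (Suc n - l) x)"
    by (rule sum.cong)
      (simp_all add: M d_def add_divide_distrib del: power_0 binomial_Suc_Suc)
  moreover have "M (T ^ 0 * S ^ 0) = 1"
    by (subst M) simp_all
  ultimately show ?thesis
    using lin by (simp only: mult_1_right)
qed

theorem theorem3:
  fixes n :: nat and a b :: real and x :: complex
  assumes "n \<ge> 1" and "a > 0" and "b > 0"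
  shows "(\<Sum>l=0..n. of_nat (n choose l)
            * of_real (pochhammer a l * pochhammer b (n - l) / pochhammer (a + b) n)
            * eulerpoly l x * eulerpoly (n - l) x)
       = 4 / of_nat (n + 1) * bernpoly (n + 1) x
         - 2 / of_nat (n + 1) * (\<Sum>l=0..n+1. of_nat ((n + 1) choose l)
            * of_real ((pochhammer a l + pochhammer b l) / pochhammer (a + b) l)
            * eulerpoly l 0 * bernpoly (n + 1 - l) x)"
    (is "?L = 4 / _ * ?B - 2 / _ * ?R")
proof -
  \<comment> \<open>The general identity is applied over the complex numbers to the images of
    \<open>a\<close> and \<open>b\<close>; the denominators are images of positive reals.\<close>
  have "pochhammer (complex_of_real a + complex_of_real b) k \<noteq> 0" for k
    using pochhammer_pos[of "a + b" k] assms(2,3)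
    by (simp add: pochhammer_of_real flip: of_real_add)
  from euler_beta_convolution[OF this, of n x]
  have eq: "of_nat (n + 1) * ?L = 4 * ?B - 2 * ?R"
    by (simp only: of_real_add of_real_mult of_real_divide atLeast0AtMost Suc_eq_plus1
        flip: pochhammer_of_real)
  have "of_nat (n + 1) \<noteq> (0 :: complex)"
    by (simp only: of_nat_eq_0_iff)
  then have "?L = of_nat (n + 1) * ?L / of_nat (n + 1)"
    by (rule nonzero_mult_div_cancel_left[symmetric])
  also have "\<dots> = 4 / of_nat (n + 1) * ?B - 2 / of_nat (n + 1) * ?R"
    by (simp only: eq diff_divide_distrib times_divide_eq_left)
  finally show ?thesis .
qed

end
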